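(* Let $\mathscr{C}=\mathrm{Set}$, $A=\mathbb{N}$ (with $0\in\mathbb{N}$), $[n]=\{1,\dots,n\}$, $F=\coprod_{n\in\mathbb{N}}[n]=\{(n,i)\mid n,i\in\mathbb{N},\ 1\le i\le n\}$, $p:F\to A$, $p(n,i)=n$, and $1_F=(1,1)\in F$. For a function $x:U\to\mathbb{N}$ identify $\llbracket x\rrbracket$ with $\coprod_{u\in U}[x(u)]$ and, for $f:\llbracket x\rrbracket\to\mathbb{N}$, define $$\Big(\sum^{x}f\Big)(u)=\sum_{i=1}^{x(u)}f(u,i),$$ $$f^\flat:\coprod_{u\in U}\coprod_{i\in[x(u)]}[f(u,i)]\to\coprod_{u\in U}\Big[\sum_{i=1}^{x(u)}f(u,i)\Big],\qquad f^\flat(u,i,j)=\Big(u,\ j+\sum_{k=1}^{i-1}f(u,k)\Big).$$ Then these data make $\mathbb{N}$ into a commutative dependent adder in $\mathrm{Set}$.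
   Context: Let $\mathscr{C}$ be a category with finite limits and terminal object $*$. A dependent adder in $\mathscr{C}$ consists of: (1) an object $A$; (2) a morphism $p:F\to A$; for $x:U\to A$ write $\llbracket x\rrbracket=U\times_A F$ (pullback of $x$ and $p$) and $p_x:\llbracket x\rrbracket\to U$ for the projection; (3) a morphism $1_F:*\to F$; put $1_A=p\circ 1_F$; (4) for every $x:U\to A$ a function $\sum^{x}:\mathrm{Hom}(\llbracket x\rrbracket,A)\to\mathrm{Hom}(U,A)$, natural in the sense that for $h:U\to U'$ and $y:U'\to A$ with $y\circ h=x$ one has $\sum^{x}(g\circ(h\times_A \mathrm{id}_F))=(\sum^{y}g)\circ h$ for all $g:\llbracket y\rrbracket\to A$; (5) for every $x:U\to A$ and $f:\llbracket x\rrbracket\to A$ a morphism $f^\flat:\llbracket f\rrbracket\to\llbracket\sum^{x}f\rrbracket$ with $p_{\sum^x f}\circ f^\flat=p_x\circ p_f$. The axioms are, for all $x:U\to A$, $f:\llbracket x\rrbracket\to A$, $g:\llbracket\sum^x f\rrbracket\to A$, writing $const_{1_A}:\llbracket x\rrbracket\to *\to A$ for the constant $1_A$ map: (Right Unit) $\sum^{x}const_{1_A}=x$; (Left Unit) $\sum^{const_{1_A}}(f\circ const_{1_A}^\flat)=f$; (Sum Associativity) $\sum^{\sum^x f}g=\sum^x\sum^f(g\circ f^\flat)$; (Flatten Associativity) $g^\flat\circ(f^\flat\times_A\mathrm{id}_F)=\big(\sum^f(g\circ f^\flat)\big)^\flat\circ(g\circ f^\flat)^\flat$ as morphisms $\llbracket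 g\circ f^\flat\rrbracket\to\llbracket\sum^x\sum^f(g\circ f^\flat)\rrbracket$. It is commutative if for all $x,y:U\to A$ and $f:\llbracket x\circ p_y\rrbracket\to A$ one has $\sum^{y}\sum^{x\circ p_y}f=\sum^{x}\sum^{y\circ p_x}(f\circ switch)$, where $switch$ is the canonical isomorphism between $\llbracket y\circ p_x\rrbracket$ and $\llbracket x\circ p_y\rrbracket$ (interchanging the two factors $F$). *)

theory Defs
  imports Main "HOL-Library.FuncSet"
begin

section \<open>Categories with finite limits\<close>

record ('o, 'm) cat =
  Obj :: "'o set"
  Arr :: "'m set"
  Dom :: "'m \<Rightarrow> 'o"
  Cod :: "'m \<Rightarrow> 'o"
  Id :: "'o \<Rightarrow> 'm"
  Comp :: "'m \<Rightarrow> 'm \<Rightarrow> 'm"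

definition Hom :: "('o, 'm) cat \<Rightarrow> 'o \<Rightarrow> 'o \<Rightarrow> 'm set" where
  "Hom C X Y = {f \<in> Arr C. Dom C f = X \<and> Cod C f = Y}"

locale category =
  fixes C :: "('o, 'm) cat"
  assumes Dom_Obj: "f \<in> Arr C \<Longrightarrow> Dom C f \<in> Obj C"
    and Cod_Obj: "f \<in> Arr C \<Longrightarrow> Cod C f \<in> Obj C"
    and Id_Hom: "X \<in> Obj C \<Longrightarrow> Id C X \<in> Hom C X X"
    and Comp_Hom: "f \<in> Hom C X Y \<Longrightarrow> g \<in> Hom C Y Z \<Longrightarrow> Comp C g f \<in> Hom C X Z"
    and Comp_Id: "f \<in> Hom C X Y \<Longrightarrow> Comp C f (Id C X) = f"
    and Id_Comp: "f \<in> Hom C X Y \<Longrightarrow> Comp C (Id C Y) f = f"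
    and Comp_assoc: "f \<in> Hom C W X \<Longrightarrow> g \<in> Hom C X Y \<Longrightarrow> h \<in> Hom C Y Z \<Longrightarrow>
      Comp C h (Comp C g f) = Comp C (Comp C h g) f"

text \<open>A finite diagram has vertices \<open>0, \<dots>, n - 1\<close>, labelled by the objects \<open>D i\<close>, and finitely
  many edges \<open>(i, m, j)\<close>, labelled by arrows \<open>m : D i \<rightarrow> D j\<close>.  A functor on a finite category and
  its underlying diagram of this kind have the same cones, hence the same limits.\<close>

definition finite_diagram ::
    "('o, 'm) cat \<Rightarrow> nat \<Rightarrow> (nat \<Rightarrow> 'o) \<Rightarrow> (nat \<times> 'm \<times> nat) set \<Rightarrow> bool" where
  "finite_diagram C n D E \<longleftrightarrow>
     (\<forall>i<n. D i \<in> Obj C) \<and> finite E \<and>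
     (\<forall>(i, m, j) \<in> E. i < n \<and> j < n \<and> m \<in> Hom C (D i) (D j))"

definition is_cone ::
    "('o, 'm) cat \<Rightarrow> nat \<Rightarrow> (nat \<Rightarrow> 'o) \<Rightarrow> (nat \<times> 'm \<times> nat) set \<Rightarrow> 'o \<Rightarrow> (nat \<Rightarrow> 'm) \<Rightarrow> bool"
  where
  "is_cone C n D E L \<pi> \<longleftrightarrow>
     L \<in> Obj C \<and> (\<forall>i<n. \<pi> i \<in> Hom C L (D i)) \<and>
     (\<forall>(i, m, j) \<in> E. Comp C m (\<pi> i) = \<pi> j)"

definition is_limit ::
    "('o, 'm) cat \<Rightarrow> nat \<Rightarrow> (nat \<Rightarrow> 'o) \<Rightarrow> (nat \<times> 'm \<times> nat) set \<Rightarrow> 'o \<Rightarrow> (nat \<Rightarrow> 'm) \<Rightarrow> bool"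
  where
  "is_limit C n D E L \<pi> \<longleftrightarrow>
     is_cone C n D E L \<pi> \<and>
     (\<forall>M \<sigma>. is_cone C n D E M \<sigma> \<longrightarrow>
        (\<exists>!k. k \<in> Hom C M L \<and> (\<forall>i<n. Comp C (\<pi> i) k = \<sigma> i)))"

definition is_terminal :: "('o, 'm) cat \<Rightarrow> 'o \<Rightarrow> bool" where
  "is_terminal C T \<longleftrightarrow> T \<in> Obj C \<and> (\<forall>X \<in> Obj C. \<exists>!k. k \<in> Hom C X T)"

definition is_pullback :: "('o, 'm) cat \<Rightarrow> 'm \<Rightarrow> 'm \<Rightarrow> 'o \<Rightarrow> 'm \<Rightarrow> 'm \<Rightarrow> bool" where
  "is_pullback C x p P a b \<longleftrightarrow>
     x \<in> Arr C \<and> p \<in> Arr C \<and> Cod C x = Cod C p \<and>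
     P \<in> Obj C \<and> a \<in> Hom C P (Dom C x) \<and> b \<in> Hom C P (Dom C p) \<and>
     Comp C x a = Comp C p b \<and>
     (\<forall>Z a' b'. a' \<in> Hom C Z (Dom C x) \<and> b' \<in> Hom C Z (Dom C p) \<and>
        Comp C x a' = Comp C p b' \<longrightarrow>
        (\<exists>!k. k \<in> Hom C Z P \<and> Comp C a k = a' \<and> Comp C b k = b'))"

locale finite_limit_category = category C for C :: "('o, 'm) cat" +
  fixes T :: 'o
  assumes finite_limits: "finite_diagram C n D E \<Longrightarrow> \<exists>L \<pi>. is_limit C n D E L \<pi>"
    and terminal: "is_terminal C T"


section \<open>Dependent adders\<close>

text \<open>For \<open>x : U \<rightarrow> A\<close>, the object \<open>ext x\<close> with the projections \<open>prU x\<close> to \<open>U\<close> and \<open>prF x\<close> to \<open>F\<close>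
  is a chosen pullback of \<open>x\<close> and \<open>p\<close>.  The domain \<open>U\<close> is determined by the arrow \<open>x\<close>.  The
  components \<open>dsum x f\<close> and \<open>flat x f\<close> depend on \<open>x\<close> and on \<open>f : ext x \<rightarrow> A\<close>.\<close>

record ('o, 'm) adder_data =
  adA :: 'o
  adF :: 'o
  adp :: 'm
  one :: 'm
  ext :: "'m \<Rightarrow> 'o"
  prU :: "'m \<Rightarrow> 'm"
  prF :: "'m \<Rightarrow> 'm"
  dsum :: "'m \<Rightarrow> 'm \<Rightarrow> 'm"
  flat :: "'m \<Rightarrow> 'm \<Rightarrow> 'm"

definition const_one :: "('o, 'm) cat \<Rightarrow> 'o \<Rightarrow> ('o, 'm) adder_data \<Rightarrow> 'o \<Rightarrow> 'm" where
  "const_one C T S X = Comp C (Comp C (adp S) (one S)) (THE k. k \<in> Hom C X T)"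

text \<open>\<open>h \<times>\<^sub>A id\<^sub>F : ext (y \<circ> h) \<rightarrow> ext y\<close>\<close>

definition base_change :: "('o, 'm) cat \<Rightarrow> ('o, 'm) adder_data \<Rightarrow> 'm \<Rightarrow> 'm \<Rightarrow> 'm" where
  "base_change C S y h =
     (THE k. k \<in> Hom C (ext S (Comp C y h)) (ext S y) \<and>
        Comp C (prU S y) k = Comp C h (prU S (Comp C y h)) \<and>
        Comp C (prF S y) k = prF S (Comp C y h))"

text \<open>The arrow \<open>ext (y \<circ> p\<^sub>x) \<rightarrow> ext (x \<circ> p\<^sub>y)\<close> over \<open>U\<close> that interchanges the two factors \<open>F\<close>\<close>

definition switch :: "('o, 'm) cat \<Rightarrow> ('o, 'm) adder_data \<Rightarrow> 'm \<Rightarrow> 'm \<Rightarrow> 'm" where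
  "switch C S x y =
     (let xy = Comp C x (prU S y); yx = Comp C y (prU S x) in
      THE k. k \<in> Hom C (ext S yx) (ext S xy) \<and>
        Comp C (prU S y) (Comp C (prU S xy) k) = Comp C (prU S x) (prU S yx) \<and>
        Comp C (prF S y) (Comp C (prU S xy) k) = prF S yx \<and>
        Comp C (prF S xy) k = Comp C (prF S x) (prU S yx))"

locale dependent_adder = finite_limit_category C T
  for C :: "('o, 'm) cat" and T :: 'o +
  fixes S :: "('o, 'm) adder_data"
  assumes A_Obj: "adA S \<in> Obj C"
    and p_Hom: "adp S \<in> Hom C (adF S) (adA S)"
    and one_Hom: "one S \<in> Hom C T (adF S)"
    and ext_pullback: "x \<in> Hom C U (adA S) \<Longrightarrow>
      is_pullback C x (adp S) (ext S x) (prU S x) (prF S x)"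
    and dsum_Hom: "x \<in> Hom C U (adA S) \<Longrightarrow> f \<in> Hom C (ext S x) (adA S) \<Longrightarrow>
      dsum S x f \<in> Hom C U (adA S)"
    and dsum_natural: "h \<in> Hom C U U' \<Longrightarrow> y \<in> Hom C U' (adA S) \<Longrightarrow> Comp C y h = x \<Longrightarrow>
      g \<in> Hom C (ext S y) (adA S) \<Longrightarrow>
      dsum S x (Comp C g (base_change C S y h)) = Comp C (dsum S y g) h"
    and flat_Hom: "x \<in> Hom C U (adA S) \<Longrightarrow> f \<in> Hom C (ext S x) (adA S) \<Longrightarrow>
      flat S x f \<in> Hom C (ext S f) (ext S (dsum S x f))"
    and flat_over: "x \<in> Hom C U (adA S) \<Longrightarrow> f \<in> Hom C (ext S x) (adA S) \<Longrightarrow>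
      Comp C (prU S (dsum S x f)) (flat S x f) = Comp C (prU S x) (prU S f)"
    and right_unit: "x \<in> Hom C U (adA S) \<Longrightarrow> dsum S x (const_one C T S (ext S x)) = x"
    and left_unit: "x \<in> Hom C U (adA S) \<Longrightarrow> f \<in> Hom C (ext S x) (adA S) \<Longrightarrow>
      dsum S (const_one C T S (ext S x))
        (Comp C f (flat S x (const_one C T S (ext S x)))) = f"
    and sum_assoc: "x \<in> Hom C U (adA S) \<Longrightarrow> f \<in> Hom C (ext S x) (adA S) \<Longrightarrow>
      g \<in> Hom C (ext S (dsum S x f)) (adA S) \<Longrightarrow>
      dsum S (dsum S x f) g = dsum S x (dsum S f (Comp C g (flat S x f)))"
    and flatten_assoc: "x \<in> Hom C U (adA S) \<Longrightarrow> f \<in> Hom C (ext S x) (adA S) \<Longrightarrow>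
      g \<in> Hom C (ext S (dsum S x f)) (adA S) \<Longrightarrow>
      Comp C (flat S (dsum S x f) g) (base_change C S g (flat S x f)) =
      Comp C (flat S x (dsum S f (Comp C g (flat S x f))))
        (flat S f (Comp C g (flat S x f)))"

locale commutative_dependent_adder = dependent_adder C T S
  for C :: "('o, 'm) cat" and T :: 'o and S :: "('o, 'm) adder_data" +
  assumes commutative: "x \<in> Hom C U (adA S) \<Longrightarrow> y \<in> Hom C U (adA S) \<Longrightarrow>
      f \<in> Hom C (ext S (Comp C x (prU S y))) (adA S) \<Longrightarrow>
      dsum S y (dsum S (Comp C x (prU S y)) f) =
      dsum S x (dsum S (Comp C y (prU S x)) (Comp C f (switch C S x y)))"


section \<open>The category of sets\<close>

text \<open>HOL has no type of all sets.  The objects of \<open>Set\<close> are the subsets of a universe that contains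
  an arbitrary type \<open>'a\<close> of atoms and the natural numbers and is closed under finite tuples; hence
  it has finite limits, and every set over every type is isomorphic to an object for a suitable
  \<open>'a\<close>.  An arrow is a function with its domain and codomain, and takes the value \<open>undefined\<close>
  outside the domain, so that arrows are equal iff they agree on the domain.\<close>

datatype 'a univ = Atom 'a | Num (num_of: nat) | Tuple (components: "'a univ list")

datatype 'a set_arrow =
  SArr (sdom: "'a univ set") (sfun: "'a univ \<Rightarrow> 'a univ") (scod: "'a univ set")

definition mk :: "'a univ set \<Rightarrow> 'a univ set \<Rightarrow> ('a univ \<Rightarrow> 'a univ) \<Rightarrow> 'a set_arrow" where
  "mk U V f = SArr U (restrict f U) V"

definition set_cat :: "('a univ set, 'a set_arrow) cat" where
  "set_cat = \<lparr>
     Obj = UNIV,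
     Arr = {m. sfun m \<in> sdom m \<rightarrow>\<^sub>E scod m},
     Dom = sdom,
     Cod = scod,
     Id = (\<lambda>U. mk U U (\<lambda>u. u)),
     Comp = (\<lambda>g f. mk (sdom f) (scod g) (\<lambda>u. sfun g (sfun f u))) \<rparr>"

definition point :: "'a univ set" where
  "point = {Tuple []}"


section \<open>The natural numbers\<close>

definition pair :: "'a univ \<Rightarrow> 'a univ \<Rightarrow> 'a univ" where
  "pair a b = Tuple [a, b]"

definition pfst :: "'a univ \<Rightarrow> 'a univ" where
  "pfst w = components w ! 0"

definition psnd :: "'a univ \<Rightarrow> 'a univ" where
  "psnd w = components w ! 1"

definition val :: "'a set_arrow \<Rightarrow> 'a univ \<Rightarrow> nat" where
  "val x u = num_of (sfun x u)"

definition natA :: "'a univ set" where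
  "natA = range Num"

definition natF :: "'a univ set" where
  "natF = {pair (Num n) (Num i) | n i. 1 \<le> i \<and> i \<le> n}"

text \<open>The chosen pullback of \<open>x : U \<rightarrow> \<nat>\<close> and \<open>p\<close> is the coproduct of the sets \<open>[x u]\<close>, that is,
  the set of pairs \<open>(u, i)\<close> with \<open>1 \<le> i \<le> x u\<close>; the projection to \<open>F\<close> maps \<open>(u, i)\<close> to
  \<open>(x u, i)\<close>.\<close>

definition nat_ext :: "'a set_arrow \<Rightarrow> 'a univ set" where
  "nat_ext x = {pair u (Num i) | u i. u \<in> sdom x \<and> 1 \<le> i \<and> i \<le> val x u}"

definition nat_dsum :: "'a set_arrow \<Rightarrow> 'a set_arrow \<Rightarrow> 'a set_arrow" where
  "nat_dsum x f = mk (sdom x) natA (\<lambda>u. Num (\<Sum>i = 1..val x u. val f (pair u (Num i))))"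

text \<open>An element \<open>(u, i, j)\<close> of the iterated coproduct is the pair of \<open>(u, i)\<close> and \<open>j\<close>.\<close>

definition nat_flat :: "'a set_arrow \<Rightarrow> 'a set_arrow \<Rightarrow> 'a set_arrow" where
  "nat_flat x f = mk (nat_ext f) (nat_ext (nat_dsum x f))
     (\<lambda>w. let u = pfst (pfst w); i = num_of (psnd (pfst w)); j = num_of (psnd w)
          in pair u (Num (j + (\<Sum>k = 1..i - 1. val f (pair u (Num k))))))"

definition nat_adder :: "('a univ set, 'a set_arrow) adder_data" where
  "nat_adder = \<lparr>
     adA = natA,
     adF = natF,
     adp = mk natF natA pfst,
     one = mk point natF (\<lambda>_. pair (Num 1) (Num 1)),
     ext = nat_ext,
     prU = (\<lambda>x. mk (nat_ext x) (sdom x) pfst),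
     prF = (\<lambda>x. mk (nat_ext x) natF (\<lambda>w. pair (sfun x (pfst w)) (psnd w))),
     dsum = nat_dsum,
     flat = nat_flat \<rparr>"

end

theory Submission imports Defs begin

text \<open>The axioms are read pointwise.  An arrow of sets is determined by its values on its domain
  (\<open>arrow_eqI\<close>), an element of an iterated extension is a nested pair, and the pullback property
  (\<open>nat_ext_pullback\<close>) turns the arrows that are given by unique existence into formulas on such
  pairs: the constant one, the base change \<open>(u, i) \<mapsto> (h u, i)\<close>, and the switch
  \<open>((u, i), j) \<mapsto> ((u, j), i)\<close>.  Each axiom then becomes an identity between finite sums of natural
  numbers over a fixed \<open>u\<close>.

  The combinatorial content is in \<open>sum_blocks\<close>.  For fixed \<open>u\<close>, the map \<open>f\<^sup>\<flat>\<close> enumerates the segment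
  \<open>1, \<dots>, \<Sum>\<^sub>k f (u, k)\<close> as consecutive blocks of lengths \<open>f (u, 1), f (u, 2), \<dots>\<close>.  Summing a function
  \<open>g\<close> over the whole segment block by block is Sum Associativity.  Flatten Associativity compares
  the offsets of an element \<open>(u, i, j, k)\<close>: on one side the sum of \<open>g\<close> over all positions before that
  of \<open>(i, j)\<close>, on the other the sum over the complete blocks before \<open>i\<close> plus the sum over the first
  \<open>j - 1\<close> elements of block \<open>i\<close>.  In the unit laws all blocks have length one, so that
  their total length is their number and flattening keeps every position.  Commutativity is the
  exchange of two finite sums.\<close>

section \<open>Arrows between sets\<close>

lemma Hom_set_cat:
  "m \<in> Hom set_cat U V \<longleftrightarrow> sdom m = U \<and> scod m = V \<and> sfun m \<in> U \<rightarrow>\<^sub>E V"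
  by (auto simp: Hom_def set_cat_def)

lemma Hom_sdom: "m \<in> Hom set_cat U V \<Longrightarrow> sdom m = U"
  and Hom_scod: "m \<in> Hom set_cat U V \<Longrightarrow> scod m = V"
  and Hom_app: "m \<in> Hom set_cat U V \<Longrightarrow> u \<in> U \<Longrightarrow> sfun m u \<in> V"
  by (auto simp: Hom_set_cat)

text \<open>The value \<open>undefined\<close> outside the domain makes pointwise agreement on the domain sufficient.\<close>

lemma arrow_eqI:
  assumes "f \<in> Hom set_cat U V" "g \<in> Hom set_cat U V"
    and "\<And>u. u \<in> U \<Longrightarrow> sfun f u = sfun g u"
  shows "f = g"
proof -
  have "sfun f = sfun g"
    using assms by (intro PiE_ext[of _ U "\<lambda>_. V"]) (auto simp: Hom_set_cat)
  then show ?thesis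
    using assms by (auto simp: Hom_set_cat intro: set_arrow.expand)
qed

lemma mk_Hom [simp]: "mk U V f \<in> Hom set_cat U V \<longleftrightarrow> (\<forall>u\<in>U. f u \<in> V)"
  by (auto simp: Hom_set_cat mk_def)

lemma sdom_mk [simp]: "sdom (mk U V f) = U"
  and scod_mk [simp]: "scod (mk U V f) = V"
  and sfun_mk [simp]: "u \<in> U \<Longrightarrow> sfun (mk U V f) u = f u"
  by (auto simp: mk_def)

lemma sdom_Comp [simp]: "sdom (Comp set_cat g f) = sdom f"
  and scod_Comp [simp]: "scod (Comp set_cat g f) = scod g"
  and sfun_Comp [simp]: "u \<in> sdom f \<Longrightarrow> sfun (Comp set_cat g f) u = sfun g (sfun f u)"
  by (auto simp: set_cat_def)

lemma Comp_set_cat_Hom: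
  "f \<in> Hom set_cat U V \<Longrightarrow> g \<in> Hom set_cat V W \<Longrightarrow> Comp set_cat g f \<in> Hom set_cat U W"
proof -
  have eq: "Comp set_cat g f = mk (sdom f) (scod g) (\<lambda>u. sfun g (sfun f u))"
    by (simp add: set_cat_def)
  show "f \<in> Hom set_cat U V \<Longrightarrow> g \<in> Hom set_cat V W \<Longrightarrow> Comp set_cat g f \<in> Hom set_cat U W"
    unfolding eq by (auto simp: Hom_set_cat mk_def PiE_iff)
qed

lemma Obj_set_cat [simp]: "U \<in> Obj set_cat"
  by (simp add: set_cat_def)

lemma category_set_cat: "category set_cat"
proof
  fix f :: "'a set_arrow"
  show "Dom set_cat f \<in> Obj set_cat" "Cod set_cat f \<in> Obj set_cat"
    by (auto simp: set_cat_def)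
next
  fix X :: "'a univ set"
  show "Id set_cat X \<in> Hom set_cat X X"
    by (auto simp: set_cat_def Hom_def mk_def)
next
  fix f g :: "'a set_arrow" and X Y Z
  assume "f \<in> Hom set_cat X Y" "g \<in> Hom set_cat Y Z"
  then show "Comp set_cat g f \<in> Hom set_cat X Z" by (rule Comp_set_cat_Hom)
next
  fix f :: "'a set_arrow" and X Y
  assume f: "f \<in> Hom set_cat X Y"
  have id: "Id set_cat V = mk V V (\<lambda>u. u)" for V :: "'a univ set"
    by (simp add: set_cat_def)
  show "Comp set_cat f (Id set_cat X) = f"
    by (rule arrow_eqI[of _ X Y]) (auto simp: id f Comp_set_cat_Hom[OF _ f])
  show "Comp set_cat (Id set_cat Y) f = f"
    by (rule arrow_eqI[of _ X Y])
      (auto simp: id f Comp_set_cat_Hom[OF f] Hom_sdom[OF f] Hom_app[OF f])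
next
  fix f g h :: "'a set_arrow" and W X Y Z
  assume "f \<in> Hom set_cat W X" "g \<in> Hom set_cat X Y" "h \<in> Hom set_cat Y Z"
  then show "Comp set_cat h (Comp set_cat g f) = Comp set_cat (Comp set_cat h g) f"
    by (intro arrow_eqI[of _ W Z])
      (auto intro!: Comp_set_cat_Hom simp: Hom_sdom Hom_app)
qed

section \<open>Finite limits of sets\<close>

text \<open>Finite tuples stay inside the universe, so the limit can be taken to be the set of
  compatible families, exactly as in the usual construction.\<close>

lemma set_cat_finite_limit:
  fixes D :: "nat \<Rightarrow> 'a univ set"
  assumes "finite_diagram set_cat n D E"
  shows "\<exists>L \<pi>. is_limit set_cat n D E L \<pi>"
proof -
  have E: "i < n" "j < n" "m \<in> Hom set_cat (D i) (D j)" if "(i, m, j) \<in> E" for i m j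
    using assms that by (auto simp: finite_diagram_def)
  define L :: "'a univ set" where "L = {Tuple xs | xs. length xs = n \<and> (\<forall>i<n. xs ! i \<in> D i) \<and>
    (\<forall>(i, m, j) \<in> E. sfun m (xs ! i) = xs ! j)}"
  define \<pi> where "\<pi> = (\<lambda>i. mk L (D i) (\<lambda>w. components w ! i))"
  have \<pi>_Hom: "\<pi> i \<in> Hom set_cat L (D i)" if "i < n" for i
    using that by (auto simp: \<pi>_def L_def)
  have cone: "is_cone set_cat n D E L \<pi>"
  proof -
    have "Comp set_cat m (\<pi> i) = \<pi> j" if "(i, m, j) \<in> E" for i m j
    proof (rule arrow_eqI[of _ L "D j"])
      show "Comp set_cat m (\<pi> i) \<in> Hom set_cat L (D j)"
        by (rule Comp_set_cat_Hom[OF \<pi>_Hom]) (use E[OF that] in auto)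
      show "\<pi> j \<in> Hom set_cat L (D j)" by (rule \<pi>_Hom) (use E[OF that] in auto)
      show "sfun (Comp set_cat m (\<pi> i)) u = sfun (\<pi> j) u" if "u \<in> L" for u
        using that \<open>(i, m, j) \<in> E\<close> by (auto simp: \<pi>_def) (auto simp: L_def)
    qed
    moreover have "L \<in> Obj set_cat" by (simp add: set_cat_def)
    ultimately show ?thesis using \<pi>_Hom by (auto simp: is_cone_def)
  qed
  have "\<exists>!k. k \<in> Hom set_cat M L \<and> (\<forall>i<n. Comp set_cat (\<pi> i) k = \<sigma> i)"
    if "is_cone set_cat n D E M \<sigma>" for M \<sigma>
  proof -
    have \<sigma>_Hom: "\<sigma> i \<in> Hom set_cat M (D i)" if "i < n" for i
      using \<open>is_cone set_cat n D E M \<sigma>\<close> that by (auto simp: is_cone_def)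
    have \<sigma>_E: "sfun m (sfun (\<sigma> i) z) = sfun (\<sigma> j) z" if "(i, m, j) \<in> E" "z \<in> M" for i m j z
    proof -
      have "Comp set_cat m (\<sigma> i) = \<sigma> j"
        using \<open>is_cone set_cat n D E M \<sigma>\<close> that by (auto simp: is_cone_def)
      moreover have "z \<in> sdom (\<sigma> i)" using Hom_sdom[OF \<sigma>_Hom] E that by auto
      ultimately show ?thesis using sfun_Comp by metis
    qed
    define k where "k = mk M L (\<lambda>z. Tuple (map (\<lambda>i. sfun (\<sigma> i) z) [0..<n]))"
    have k: "k \<in> Hom set_cat M L"
      using \<sigma>_E E Hom_app[OF \<sigma>_Hom] by (fastforce simp: k_def L_def)
    show ?thesis
    proof (rule ex1I[of _ k], intro conjI allI impI)
      show "k \<in> Hom set_cat M L" by (rule k)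
      show "Comp set_cat (\<pi> i) k = \<sigma> i" if "i < n" for i
      proof (rule arrow_eqI[of _ M "D i"])
        show "Comp set_cat (\<pi> i) k \<in> Hom set_cat M (D i)"
          by (rule Comp_set_cat_Hom[OF k \<pi>_Hom[OF that]])
        show "\<sigma> i \<in> Hom set_cat M (D i)" by (rule \<sigma>_Hom[OF that])
        show "sfun (Comp set_cat (\<pi> i) k) u = sfun (\<sigma> i) u" if "u \<in> M" for u
          using Hom_app[OF k that] that \<open>i < n\<close> by (auto simp: \<pi>_def k_def)
      qed
    next
      fix k' assume k': "k' \<in> Hom set_cat M L \<and> (\<forall>i<n. Comp set_cat (\<pi> i) k' = \<sigma> i)"
      show "k' = k"
      proof (rule arrow_eqI[of _ M L])
        fix z assume z: "z \<in> M"
        have "sfun k' z \<in> L" using k' z Hom_app by blast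
        then obtain xs where xs: "sfun k' z = Tuple xs" "length xs = n"
          by (auto simp: L_def)
        have "xs ! i = sfun (\<sigma> i) z" if "i < n" for i
        proof -
          have "sfun (\<sigma> i) z = sfun (\<pi> i) (sfun k' z)"
            using k' that z sfun_Comp Hom_sdom by metis
          also have "\<dots> = xs ! i" using \<open>sfun k' z \<in> L\<close> xs by (simp add: \<pi>_def)
          finally show ?thesis by simp
        qed
        then show "sfun k' z = sfun k z"
          using xs z by (auto simp: k_def intro!: nth_equalityI)
      qed (use k k' in auto)
    qed
  qed
  with cone have "is_limit set_cat n D E L \<pi>" by (auto simp: is_limit_def)
  then show ?thesis by blast
qed

lemma Hom_point_ex1: "\<exists>!k. k \<in> Hom set_cat X point"
proof (rule ex1I[of _ "mk X point (\<lambda>_. Tuple [])"])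
  show "mk X point (\<lambda>_. Tuple []) \<in> Hom set_cat X point" by (simp add: point_def)
  show "k = mk X point (\<lambda>_. Tuple [])" if "k \<in> Hom set_cat X point" for k
    by (rule arrow_eqI[OF that]) (use Hom_app[OF that] in \<open>auto simp: point_def\<close>)
qed

lemma finite_limit_category_set_cat:
  "finite_limit_category (set_cat :: ('a univ set, 'a set_arrow) cat) point"
proof -
  interpret category "set_cat :: ('a univ set, 'a set_arrow) cat" by (rule category_set_cat)
  show ?thesis
  proof
    show "is_terminal (set_cat :: ('a univ set, 'a set_arrow) cat) point"
      unfolding is_terminal_def by (intro conjI ballI Hom_point_ex1) (simp add: set_cat_def)
  qed (rule set_cat_finite_limit)
qed

section \<open>Extensions and the arrows between them\<close>

lemma pair_simps [simp]:
  "pfst (pair a b) = a" "psnd (pair a b) = b" "pair a b = pair c d \<longleftrightarrow> a = c \<and> b = d"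
  by (auto simp: pair_def pfst_def psnd_def)

lemma nat_adder_simps [simp]:
  "adA nat_adder = natA" "adF nat_adder = natF" "adp nat_adder = mk natF natA pfst"
  "one nat_adder = mk point natF (\<lambda>_. pair (Num 1) (Num 1))"
  "ext nat_adder = nat_ext" "dsum nat_adder = nat_dsum" "flat nat_adder = nat_flat"
  "prU nat_adder x = mk (nat_ext x) (sdom x) pfst"
  "prF nat_adder x = mk (nat_ext x) natF (\<lambda>w. pair (sfun x (pfst w)) (psnd w))"
  by (simp_all add: nat_adder_def)

lemma Num_in_natA [simp]: "Num n \<in> natA"
  by (simp add: natA_def)

lemma pair_in_natF [simp]: "pair (Num n) (Num i) \<in> natF \<longleftrightarrow> 1 \<le> i \<and> i \<le> n"
  by (auto simp: natF_def)

lemma pair_in_nat_ext [simp]: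
  "pair u (Num i) \<in> nat_ext x \<longleftrightarrow> u \<in> sdom x \<and> 1 \<le> i \<and> i \<le> val x u"
  by (auto simp: nat_ext_def)

lemma nat_extE:
  assumes "w \<in> nat_ext x"
  obtains u i where "w = pair u (Num i)" "u \<in> sdom x" "1 \<le> i" "i \<le> val x u"
  using assms by (auto simp: nat_ext_def)

lemma sfun_eq_Num_val: "x \<in> Hom set_cat U natA \<Longrightarrow> u \<in> U \<Longrightarrow> sfun x u = Num (val x u)"
  using Hom_app[of x U natA u] by (auto simp: val_def natA_def)

lemma val_mk [simp]: "u \<in> U \<Longrightarrow> val (mk U V f) u = num_of (f u)"
  by (simp add: val_def)

lemma val_Comp [simp]: "u \<in> sdom f \<Longrightarrow> val (Comp set_cat g f) u = val g (sfun f u)"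
  by (simp add: val_def)

lemma prU_Hom: "x \<in> Hom set_cat U natA \<Longrightarrow> prU nat_adder x \<in> Hom set_cat (nat_ext x) U"
  by (auto elim!: nat_extE simp: Hom_sdom)

lemma prF_Hom: "x \<in> Hom set_cat U natA \<Longrightarrow> prF nat_adder x \<in> Hom set_cat (nat_ext x) natF"
  by (auto elim!: nat_extE simp: Hom_sdom sfun_eq_Num_val)

text \<open>The first projection recovers \<open>u\<close> and the second recovers \<open>i\<close>.  This is the uniqueness half of
  the pullback property; it also identifies arrows that are defined by the values of their
  projections.\<close>

lemma nat_ext_jointly_monic:
  assumes x: "x \<in> Hom set_cat U natA"
    and k: "k \<in> Hom set_cat Z (nat_ext x)" "k' \<in> Hom set_cat Z (nat_ext x)"
    and U: "Comp set_cat (prU nat_adder x) k = Comp set_cat (prU nat_adder x) k'"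
    and F: "Comp set_cat (prF nat_adder x) k = Comp set_cat (prF nat_adder x) k'"
  shows "k = k'"
proof (rule arrow_eqI[OF k])
  fix z assume z: "z \<in> Z"
  have *: "sfun k z \<in> nat_ext x" "sfun k' z \<in> nat_ext x" using k z Hom_app by blast+
  have "sfun (Comp set_cat (prU nat_adder x) k) z = sfun (Comp set_cat (prU nat_adder x) k') z"
    "sfun (Comp set_cat (prF nat_adder x) k) z = sfun (Comp set_cat (prF nat_adder x) k') z"
    using U F by simp_all
  then have "pfst (sfun k z) = pfst (sfun k' z)" "psnd (sfun k z) = psnd (sfun k' z)"
    using z * k by (simp_all add: Hom_sdom)
  then show "sfun k z = sfun k' z" using * by (auto elim!: nat_extE)
qed

text \<open>For a commuting square with legs \<open>a\<close> and \<open>b\<close>, the element \<open>b z\<close> of \<open>F\<close> must be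
  \<open>(x (a z), i)\<close> with \<open>1 \<le> i \<le> x (a z)\<close>, so the mediating arrow maps \<open>z\<close> to \<open>(a z, i)\<close>.\<close>

lemma nat_ext_pullback:
  assumes x: "x \<in> Hom set_cat U natA"
  shows "is_pullback set_cat x (mk natF natA pfst) (nat_ext x) (prU nat_adder x) (prF nat_adder x)"
proof -
  let ?p = "mk natF natA pfst :: 'a set_arrow"
  have p: "?p \<in> Hom set_cat natF natA" by (auto simp: natF_def)
  have ends: "x \<in> Arr set_cat" "?p \<in> Arr set_cat" "Dom set_cat x = U" "Cod set_cat x = natA"
    "Dom set_cat ?p = natF" "Cod set_cat ?p = natA"
    using x p by (auto simp: Hom_def)
  have square: "Comp set_cat x (prU nat_adder x) = Comp set_cat ?p (prF nat_adder x)"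
  proof (rule arrow_eqI[of _ "nat_ext x" natA])
    fix w assume "w \<in> nat_ext x"
    then show "sfun (Comp set_cat x (prU nat_adder x)) w = sfun (Comp set_cat ?p (prF nat_adder x)) w"
      using x by (auto elim!: nat_extE simp: Hom_sdom sfun_eq_Num_val)
  qed (rule Comp_set_cat_Hom[OF prU_Hom[OF x] x] Comp_set_cat_Hom[OF prF_Hom[OF x] p])+
  have univ: "\<exists>!k. k \<in> Hom set_cat Z (nat_ext x) \<and> Comp set_cat (prU nat_adder x) k = a \<and>
      Comp set_cat (prF nat_adder x) k = b"
    if a: "a \<in> Hom set_cat Z U" and b: "b \<in> Hom set_cat Z natF"
      and eq: "Comp set_cat x a = Comp set_cat ?p b" for Z a b
  proof -
    define k where "k = mk Z (nat_ext x) (\<lambda>z. pair (sfun a z) (psnd (sfun b z)))"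
    have b_form: "\<exists>i. sfun b z = pair (sfun x (sfun a z)) (Num i) \<and> 1 \<le> i \<and> i \<le> val x (sfun a z)"
      if z: "z \<in> Z" for z
    proof -
      have bz: "sfun b z \<in> natF" using Hom_app[OF b z] .
      then obtain n i where ni: "sfun b z = pair (Num n) (Num i)" "1 \<le> i" "i \<le> n"
        by (auto simp: natF_def)
      have "sfun (Comp set_cat x a) z = sfun (Comp set_cat ?p b) z" using eq by simp
      then have "sfun x (sfun a z) = Num n"
        using z a b bz ni by (simp add: Hom_sdom)
      then show ?thesis using ni by (auto simp: val_def)
    qed
    have k: "k \<in> Hom set_cat Z (nat_ext x)"
      using b_form Hom_app[OF a] by (fastforce simp: k_def Hom_sdom[OF x])
    have kU: "Comp set_cat (prU nat_adder x) k = a"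
    proof (rule arrow_eqI[OF Comp_set_cat_Hom[OF k prU_Hom[OF x]] a])
      fix z assume "z \<in> Z"
      then show "sfun (Comp set_cat (prU nat_adder x) k) z = sfun a z"
        using Hom_app[OF k] by (auto simp: k_def)
    qed
    have kF: "Comp set_cat (prF nat_adder x) k = b"
    proof (rule arrow_eqI[OF Comp_set_cat_Hom[OF k prF_Hom[OF x]] b])
      fix z assume "z \<in> Z"
      then show "sfun (Comp set_cat (prF nat_adder x) k) z = sfun b z"
        using Hom_app[OF k] b_form by (fastforce simp: k_def)
    qed
    show ?thesis
      by (rule ex1I[of _ k]) (use k kU kF nat_ext_jointly_monic[OF x] in auto)
  qed
  show ?thesis
    unfolding is_pullback_def ends
    using univ ends square prU_Hom[OF x] prF_Hom[OF x] by (intro conjI allI impI) (blast | simp)+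
qed

lemma const_one_nat_adder:
  "const_one set_cat point nat_adder X = mk X natA (\<lambda>_. Num 1)"
proof -
  let ?k = "THE k. k \<in> Hom set_cat X point"
  let ?o = "mk point natF (\<lambda>_. pair (Num 1) (Num 1)) :: 'a set_arrow"
  have k: "?k \<in> Hom set_cat X point" by (rule theI'[OF Hom_point_ex1])
  have o: "?o \<in> Hom set_cat point natF" by simp
  have p: "mk natF natA pfst \<in> Hom set_cat natF natA" by (auto simp: natF_def)
  show ?thesis
    unfolding const_one_def nat_adder_simps
  proof (rule arrow_eqI[OF Comp_set_cat_Hom[OF k Comp_set_cat_Hom[OF o p]]])
    fix u assume "u \<in> X"
    then show "sfun (Comp set_cat (Comp set_cat (mk natF natA pfst) ?o) ?k) u
        = sfun (mk X natA (\<lambda>_. Num 1)) u"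
      using Hom_app[OF k] by (simp add: Hom_sdom[OF k])
  qed simp
qed

lemma base_change_nat_adder:
  assumes h: "h \<in> Hom set_cat U U'" and y: "y \<in> Hom set_cat U' natA"
  shows "base_change set_cat nat_adder y h =
    mk (nat_ext (Comp set_cat y h)) (nat_ext y) (\<lambda>w. pair (sfun h (pfst w)) (psnd w))"
    (is "_ = ?b")
proof -
  let ?x = "Comp set_cat y h"
  have x: "?x \<in> Hom set_cat U natA" by (rule Comp_set_cat_Hom[OF h y])
  have b: "?b \<in> Hom set_cat (nat_ext ?x) (nat_ext y)"
    using h y by (auto elim!: nat_extE simp: Hom_sdom Hom_app)
  have bU: "Comp set_cat (prU nat_adder y) ?b = Comp set_cat h (prU nat_adder ?x)"
    by (rule arrow_eqI[OF Comp_set_cat_Hom[OF b prU_Hom[OF y]] Comp_set_cat_Hom[OF prU_Hom[OF x] h]])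
      (use h y in \<open>auto elim!: nat_extE simp: Hom_sdom Hom_app\<close>)
  have bF: "Comp set_cat (prF nat_adder y) ?b = prF nat_adder ?x"
    by (rule arrow_eqI[OF Comp_set_cat_Hom[OF b prF_Hom[OF y]] prF_Hom[OF x]])
      (use h y in \<open>auto elim!: nat_extE simp: Hom_sdom Hom_app\<close>)
  show ?thesis
    unfolding base_change_def
  proof (rule the_equality)
    fix k
    assume k: "k \<in> Hom set_cat (ext nat_adder ?x) (ext nat_adder y) \<and>
      Comp set_cat (prU nat_adder y) k = Comp set_cat h (prU nat_adder ?x) \<and>
      Comp set_cat (prF nat_adder y) k = prF nat_adder ?x"
    show "k = ?b"
      by (rule nat_ext_jointly_monic[OF y _ b]) (use k bU bF in auto)
  qed (use b bU bF in auto)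
qed

lemma switch_nat_adder:
  assumes x: "x \<in> Hom set_cat U natA" and y: "y \<in> Hom set_cat U natA"
  shows "switch set_cat nat_adder x y =
    mk (nat_ext (Comp set_cat y (prU nat_adder x))) (nat_ext (Comp set_cat x (prU nat_adder y)))
      (\<lambda>w. pair (pair (pfst (pfst w)) (psnd w)) (psnd (pfst w)))"
    (is "_ = ?s")
proof -
  let ?xy = "Comp set_cat x (prU nat_adder y)" and ?yx = "Comp set_cat y (prU nat_adder x)"
  have xy: "?xy \<in> Hom set_cat (nat_ext y) natA" by (rule Comp_set_cat_Hom[OF prU_Hom[OF y] x])
  have yx: "?yx \<in> Hom set_cat (nat_ext x) natA" by (rule Comp_set_cat_Hom[OF prU_Hom[OF x] y])
  have s: "?s \<in> Hom set_cat (nat_ext ?yx) (nat_ext ?xy)"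
    using x y by (auto elim!: nat_extE simp: Hom_sdom Hom_app)
  note ys = Comp_set_cat_Hom[OF s prU_Hom[OF xy]]
  have sUU: "Comp set_cat (prU nat_adder y) (Comp set_cat (prU nat_adder ?xy) ?s) =
      Comp set_cat (prU nat_adder x) (prU nat_adder ?yx)"
    by (rule arrow_eqI[OF Comp_set_cat_Hom[OF ys prU_Hom[OF y]]
          Comp_set_cat_Hom[OF prU_Hom[OF yx] prU_Hom[OF x]]])
      (use x y in \<open>auto elim!: nat_extE simp: Hom_sdom Hom_app\<close>)
  have sFU: "Comp set_cat (prF nat_adder y) (Comp set_cat (prU nat_adder ?xy) ?s) =
      prF nat_adder ?yx"
    by (rule arrow_eqI[OF Comp_set_cat_Hom[OF ys prF_Hom[OF y]] prF_Hom[OF yx]])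
      (use x y in \<open>auto elim!: nat_extE simp: Hom_sdom Hom_app\<close>)
  have sF: "Comp set_cat (prF nat_adder ?xy) ?s =
      Comp set_cat (prF nat_adder x) (prU nat_adder ?yx)"
    by (rule arrow_eqI[OF Comp_set_cat_Hom[OF s prF_Hom[OF xy]]
          Comp_set_cat_Hom[OF prU_Hom[OF yx] prF_Hom[OF x]]])
      (use x y in \<open>auto elim!: nat_extE simp: Hom_sdom Hom_app\<close>)
  show ?thesis
    unfolding switch_def Let_def
  proof (rule the_equality)
    fix k
    assume k: "k \<in> Hom set_cat (ext nat_adder ?yx) (ext nat_adder ?xy) \<and>
      Comp set_cat (prU nat_adder y) (Comp set_cat (prU nat_adder ?xy) k) =
        Comp set_cat (prU nat_adder x) (prU nat_adder ?yx) \<and>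
      Comp set_cat (prF nat_adder y) (Comp set_cat (prU nat_adder ?xy) k) = prF nat_adder ?yx \<and>
      Comp set_cat (prF nat_adder ?xy) k = Comp set_cat (prF nat_adder x) (prU nat_adder ?yx)"
    then have k_Hom: "k \<in> Hom set_cat (nat_ext ?yx) (nat_ext ?xy)" by simp
    \<comment> \<open>The iterated extension is a pullback of a pullback, so joint monicity is used twice.\<close>
    have "Comp set_cat (prU nat_adder ?xy) k = Comp set_cat (prU nat_adder ?xy) ?s"
      by (rule nat_ext_jointly_monic[OF y Comp_set_cat_Hom[OF k_Hom prU_Hom[OF xy]] ys])
        (use k sUU sFU in presburger)+
    then show "k = ?s"
      by (rule nat_ext_jointly_monic[OF xy k_Hom s]) (use k sF in presburger)
  qed (use s sUU sFU sF in auto)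
qed

section \<open>Sums over consecutive blocks\<close>

text \<open>The segment is cut into \<open>n\<close> consecutive blocks of lengths \<open>F 1, \<dots>, F n\<close> and a remainder of
  length \<open>j\<close>.  Sum Associativity needs only \<open>j = 0\<close>; in Flatten Associativity the remainder consists
  of the elements that precede a given one inside its own block.  The induction takes \<open>j\<close> arbitrary
  because the last block is first absorbed into the remainder and then split off from it.\<close>

lemma sum_blocks:
  fixes F :: "nat \<Rightarrow> nat" and G :: "nat \<Rightarrow> 'b::comm_monoid_add"
  shows "(\<Sum>l = 1..j + (\<Sum>k = 1..n. F k). G l) =
    (\<Sum>m = 1..n. \<Sum>l = 1..F m. G (l + (\<Sum>k = 1..m - 1. F k))) +
    (\<Sum>l = 1..j. G (l + (\<Sum>k = 1..n. F k)))"
proof (induction n arbitrary: j)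
  case 0
  then show ?case by simp
next
  case (Suc n)
  have split: "(\<Sum>l = 1..a + b. H l) = (\<Sum>l = 1..a. H l) + (\<Sum>l = 1..b. H (l + a))"
    for a b :: nat and H :: "nat \<Rightarrow> 'b"
    by (induction b) (simp_all add: add.assoc add.commute[of a])
  have "(\<Sum>l = 1..j + (\<Sum>k = 1..Suc n. F k). G l) =
      (\<Sum>l = 1..(F (Suc n) + j) + (\<Sum>k = 1..n. F k). G l)"
    by (simp add: ac_simps)
  also have "\<dots> = (\<Sum>m = 1..n. \<Sum>l = 1..F m. G (l + (\<Sum>k = 1..m - 1. F k))) +
      (\<Sum>l = 1..F (Suc n) + j. G (l + (\<Sum>k = 1..n. F k)))"
    by (rule Suc.IH)
  also have "(\<Sum>l = 1..F (Suc n) + j. G (l + (\<Sum>k = 1..n. F k))) =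
      (\<Sum>l = 1..F (Suc n). G (l + (\<Sum>k = 1..n. F k))) +
      (\<Sum>l = 1..j. G (l + (\<Sum>k = 1..Suc n. F k)))"
    by (subst split) (simp add: ac_simps)
  finally show ?case by (simp add: add.assoc)
qed

text \<open>This bound makes \<open>f\<^sup>\<flat>\<close> take values in its codomain: the left-hand side is the position of the
  \<open>j\<close>-th element of block \<open>i\<close>, hence at most the position where that block ends.\<close>

lemma block_position_le:
  fixes F :: "nat \<Rightarrow> nat"
  assumes "1 \<le> i" "i \<le> n" "j \<le> F i"
  shows "j + (\<Sum>k = 1..i - 1. F k) \<le> (\<Sum>k = 1..n. F k)"
proof -
  have "j + (\<Sum>k = 1..i - 1. F k) \<le> F i + (\<Sum>k = 1..i - 1. F k)" using assms by simp
  also have "\<dots> = (\<Sum>k = 1..i. F k)" using assms by (cases i) auto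
  also have "\<dots> \<le> (\<Sum>k = 1..n. F k)" using assms by (intro sum_mono2) auto
  finally show ?thesis .
qed

section \<open>The adder of the natural numbers\<close>

lemma sdom_nat_dsum [simp]: "sdom (nat_dsum x f) = sdom x"
  by (simp add: nat_dsum_def)

lemma val_nat_dsum [simp]:
  "u \<in> sdom x \<Longrightarrow> val (nat_dsum x f) u = (\<Sum>i = 1..val x u. val f (pair u (Num i)))"
  by (simp add: nat_dsum_def)

lemma nat_dsum_Hom: "x \<in> Hom set_cat U natA \<Longrightarrow> nat_dsum x f \<in> Hom set_cat U natA"
  by (auto simp: nat_dsum_def Hom_sdom)

lemma nat_arrow_eqI:
  assumes "f \<in> Hom set_cat U natA" "g \<in> Hom set_cat U natA"
    and "\<And>u. u \<in> U \<Longrightarrow> val f u = val g u"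
  shows "f = g"
  using assms by (intro arrow_eqI[of f U natA g]) (auto simp: sfun_eq_Num_val)

lemma sdom_nat_flat [simp]: "sdom (nat_flat x f) = nat_ext f"
  by (simp add: nat_flat_def)

lemma sfun_nat_flat [simp]:
  "pair (pair u (Num i)) (Num j) \<in> nat_ext f \<Longrightarrow>
   sfun (nat_flat x f) (pair (pair u (Num i)) (Num j)) =
     pair u (Num (j + (\<Sum>k = 1..i - 1. val f (pair u (Num k)))))"
  by (simp add: nat_flat_def del: pair_in_nat_ext)

lemma nat_flat_Hom:
  assumes x: "x \<in> Hom set_cat U natA" and f: "f \<in> Hom set_cat (nat_ext x) natA"
  shows "nat_flat x f \<in> Hom set_cat (nat_ext f) (nat_ext (nat_dsum x f))"
  using block_position_le[where F = "\<lambda>k. val f (pair _ (Num k))"]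
  by (auto simp: nat_flat_def Hom_sdom[OF f] Let_def elim!: nat_extE)

lemma nat_dsum_assoc:
  assumes x: "x \<in> Hom set_cat U natA" and f: "f \<in> Hom set_cat (nat_ext x) natA"
  shows "nat_dsum (nat_dsum x f) g = nat_dsum x (nat_dsum f (Comp set_cat g (nat_flat x f)))"
proof (rule nat_arrow_eqI[OF nat_dsum_Hom[OF nat_dsum_Hom[OF x]] nat_dsum_Hom[OF x]])
  fix u assume u: "u \<in> U"
  let ?F = "\<lambda>k. val f (pair u (Num k))" and ?G = "\<lambda>l. val g (pair u (Num l))"
  have "val (nat_dsum (nat_dsum x f) g) u = (\<Sum>l = 1..0 + (\<Sum>k = 1..val x u. ?F k). ?G l)"
    using u by (simp add: Hom_sdom[OF x])
  also have "\<dots> = (\<Sum>m = 1..val x u. \<Sum>l = 1..?F m. ?G (l + (\<Sum>k = 1..m - 1. ?F k)))"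
    by (subst sum_blocks) simp
  also have "\<dots> = val (nat_dsum x (nat_dsum f (Comp set_cat g (nat_flat x f)))) u"
    using u by (simp add: Hom_sdom[OF x] Hom_sdom[OF f])
  finally show "val (nat_dsum (nat_dsum x f) g) u =
      val (nat_dsum x (nat_dsum f (Comp set_cat g (nat_flat x f)))) u" .
qed

lemma nat_flat_assoc:
  assumes x: "x \<in> Hom set_cat U natA" and f: "f \<in> Hom set_cat (nat_ext x) natA"
    and g: "g \<in> Hom set_cat (nat_ext (nat_dsum x f)) natA"
  shows "Comp set_cat (nat_flat (nat_dsum x f) g) (base_change set_cat nat_adder g (nat_flat x f)) =
    Comp set_cat (nat_flat x (nat_dsum f (Comp set_cat g (nat_flat x f))))
      (nat_flat f (Comp set_cat g (nat_flat x f)))"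
proof -
  let ?gf = "Comp set_cat g (nat_flat x f)"
  let ?b = "base_change set_cat nat_adder g (nat_flat x f)"
  note flat = nat_flat_Hom[OF x f]
  have gf: "?gf \<in> Hom set_cat (nat_ext f) natA" by (rule Comp_set_cat_Hom[OF flat g])
  have b_eq: "?b = mk (nat_ext ?gf) (nat_ext g) (\<lambda>w. pair (sfun (nat_flat x f) (pfst w)) (psnd w))"
    by (rule base_change_nat_adder[OF flat g])
  have b: "?b \<in> Hom set_cat (nat_ext ?gf) (nat_ext g)"
    unfolding b_eq using Hom_app[OF flat]
    by (auto elim!: nat_extE simp: Hom_sdom[OF g] simp del: sfun_nat_flat)
  show ?thesis
  proof (rule arrow_eqI)
    show "Comp set_cat (nat_flat (nat_dsum x f) g) ?b
        \<in> Hom set_cat (nat_ext ?gf) (nat_ext (nat_dsum (nat_dsum x f) g))"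
      by (rule Comp_set_cat_Hom[OF b nat_flat_Hom[OF nat_dsum_Hom[OF x] g]])
    show "Comp set_cat (nat_flat x (nat_dsum f ?gf)) (nat_flat f ?gf)
        \<in> Hom set_cat (nat_ext ?gf) (nat_ext (nat_dsum (nat_dsum x f) g))"
      unfolding nat_dsum_assoc[OF x f]
      by (rule Comp_set_cat_Hom[OF nat_flat_Hom[OF f gf] nat_flat_Hom[OF x nat_dsum_Hom[OF f]]])
  next
    fix w assume w: "w \<in> nat_ext ?gf"
    then obtain v k where wv: "w = pair v (Num k)" "v \<in> nat_ext f" by (auto elim!: nat_extE)
    then obtain t j where v: "v = pair t (Num j)" "t \<in> nat_ext x" "1 \<le> j" "j \<le> val f t"
      using Hom_sdom[OF f] by (auto elim!: nat_extE)
    then obtain u i where t: "t = pair u (Num i)" "u \<in> U" "1 \<le> i" "i \<le> val x u"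
      using Hom_sdom[OF x] by (auto elim!: nat_extE)
    let ?F = "\<lambda>k. val f (pair u (Num k))" and ?G = "\<lambda>l. val g (pair u (Num l))"
    let ?s = "\<Sum>k = 1..i - 1. ?F k"
    have w_eq: "w = pair (pair (pair u (Num i)) (Num j)) (Num k)" by (simp add: wv v t)
    have bw: "sfun ?b w = pair (pair u (Num (j + ?s))) (Num k)"
    proof -
      have "sfun (nat_flat x f) v = pair u (Num (j + ?s))"
        using wv(2) unfolding v t by (rule sfun_nat_flat)
      then show ?thesis unfolding b_eq sfun_mk[OF w] by (simp add: wv(1))
    qed
    have "sfun ?b w \<in> nat_ext g" by (rule Hom_app[OF b w])
    then have "sfun (Comp set_cat (nat_flat (nat_dsum x f) g) ?b) w =
        pair u (Num (k + (\<Sum>l = 1..j + ?s - 1. ?G l)))"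
      using w Hom_sdom[OF b] unfolding bw by (simp add: bw del: pair_in_nat_ext)
    \<comment> \<open>The predecessors of position \<open>j\<close> in block \<open>i\<close> are \<open>i - 1\<close> full blocks and
      \<open>j - 1\<close> further elements.\<close>
    also have "j + ?s - 1 = (j - 1) + ?s" using v by simp
    also have "(\<Sum>l = 1..(j - 1) + ?s. ?G l) =
        (\<Sum>m = 1..i - 1. \<Sum>l = 1..?F m. ?G (l + (\<Sum>k = 1..m - 1. ?F k))) +
        (\<Sum>l = 1..j - 1. ?G (l + ?s))"
      by (rule sum_blocks)
    also have "(\<Sum>m = 1..i - 1. \<Sum>l = 1..?F m. ?G (l + (\<Sum>k = 1..m - 1. ?F k))) =
        (\<Sum>m = 1..i - 1. val (nat_dsum f ?gf) (pair u (Num m)))"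
      using t by (intro sum.cong) (auto simp: Hom_sdom[OF f] Hom_sdom[OF x])
    also have "(\<Sum>l = 1..j - 1. ?G (l + ?s)) =
        (\<Sum>l = 1..j - 1. val ?gf (pair (pair u (Num i)) (Num l)))"
      using t v by (intro sum.cong) (auto simp: Hom_sdom[OF f] Hom_sdom[OF x])
    also have "pair u (Num (k + ((\<Sum>m = 1..i - 1. val (nat_dsum f ?gf) (pair u (Num m))) +
          (\<Sum>l = 1..j - 1. val ?gf (pair (pair u (Num i)) (Num l)))))) =
        sfun (Comp set_cat (nat_flat x (nat_dsum f ?gf)) (nat_flat f ?gf)) w"
    proof -
      have fw: "sfun (nat_flat f ?gf) w = pair (pair u (Num i))
          (Num (k + (\<Sum>l = 1..j - 1. val ?gf (pair (pair u (Num i)) (Num l)))))"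
        using w unfolding w_eq by (rule sfun_nat_flat)
      have "sfun (nat_flat f ?gf) w \<in> nat_ext (nat_dsum f ?gf)"
        by (rule Hom_app[OF nat_flat_Hom[OF f gf] w])
      then show ?thesis
        using w by (simp add: fw add.assoc add.commute del: pair_in_nat_ext val_nat_dsum val_Comp)
    qed
    finally show "sfun (Comp set_cat (nat_flat (nat_dsum x f) g) ?b) w =
        sfun (Comp set_cat (nat_flat x (nat_dsum f ?gf)) (nat_flat f ?gf)) w" .
  qed
qed

lemma dependent_adder_nat:
  "dependent_adder (set_cat :: ('a univ set, 'a set_arrow) cat) point nat_adder"
proof -
  interpret finite_limit_category "set_cat :: ('a univ set, 'a set_arrow) cat" point
    by (rule finite_limit_category_set_cat)
  show ?thesis
  proof (unfold_locales, unfold nat_adder_simps(1-7))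
    show "natA \<in> Obj (set_cat :: ('a univ set, 'a set_arrow) cat)" by (simp add: set_cat_def)
    show "(mk natF natA pfst :: 'a set_arrow) \<in> Hom set_cat natF natA" by (auto simp: natF_def)
    show "(mk point natF (\<lambda>_. pair (Num 1) (Num 1)) :: 'a set_arrow) \<in> Hom set_cat point natF"
      by simp
  next
    fix x :: "'a set_arrow" and U
    assume x: "x \<in> Hom set_cat U natA"
    show "is_pullback set_cat x (mk natF natA pfst) (nat_ext x) (prU nat_adder x) (prF nat_adder x)"
      by (rule nat_ext_pullback[OF x])
    show "nat_dsum x (const_one set_cat point nat_adder (nat_ext x)) = x"
      unfolding const_one_nat_adder
      by (rule nat_arrow_eqI[OF nat_dsum_Hom[OF x] x]) (simp add: Hom_sdom[OF x])
  next
    fix x f :: "'a set_arrow" and U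
    assume x: "x \<in> Hom set_cat U natA" and f: "f \<in> Hom set_cat (nat_ext x) natA"
    show "nat_dsum x f \<in> Hom set_cat U natA" by (rule nat_dsum_Hom[OF x])
    show flat: "nat_flat x f \<in> Hom set_cat (nat_ext f) (nat_ext (nat_dsum x f))"
      by (rule nat_flat_Hom[OF x f])
    show "Comp set_cat (prU nat_adder (nat_dsum x f)) (nat_flat x f) =
        Comp set_cat (prU nat_adder x) (prU nat_adder f)"
    proof (rule arrow_eqI[OF Comp_set_cat_Hom[OF flat prU_Hom[OF nat_dsum_Hom[OF x]]]
          Comp_set_cat_Hom[OF prU_Hom[OF f] prU_Hom[OF x]]])
      fix w assume w: "w \<in> nat_ext f"
      with Hom_app[OF flat w]
      show "sfun (Comp set_cat (prU nat_adder (nat_dsum x f)) (nat_flat x f)) w =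
          sfun (Comp set_cat (prU nat_adder x) (prU nat_adder f)) w"
        by (auto simp: Hom_sdom[OF f] elim!: nat_extE)
    qed
    show "nat_dsum (const_one set_cat point nat_adder (nat_ext x))
        (Comp set_cat f (nat_flat x (const_one set_cat point nat_adder (nat_ext x)))) = f"
      unfolding const_one_nat_adder
    proof (rule nat_arrow_eqI[OF nat_dsum_Hom f])
      let ?one = "mk (nat_ext x) natA (\<lambda>_. Num 1)"
      show "?one \<in> Hom set_cat (nat_ext x) natA" by simp
      fix w assume w: "w \<in> nat_ext x"
      then obtain u i where ui: "w = pair u (Num i)" "u \<in> sdom x" "1 \<le> i" "i \<le> val x u"
        by (rule nat_extE)
      \<comment> \<open>Blocks of length one leave every element at its position.\<close>
      have "(\<Sum>k = 1..i - 1. val ?one (pair u (Num k))) = (\<Sum>k = 1..i - 1. 1)"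
        using ui by (intro sum.cong) auto
      then show "val (nat_dsum ?one (Comp set_cat f (nat_flat x ?one))) w = val f w"
        using w ui by simp
    qed
  next
    fix h x y g :: "'a set_arrow" and U U'
    assume h: "h \<in> Hom set_cat U U'" and y: "y \<in> Hom set_cat U' natA"
      and eq: "Comp set_cat y h = x" and g: "g \<in> Hom set_cat (nat_ext y) natA"
    have x: "x \<in> Hom set_cat U natA" unfolding eq[symmetric] by (rule Comp_set_cat_Hom[OF h y])
    show "nat_dsum x (Comp set_cat g (base_change set_cat nat_adder y h)) =
        Comp set_cat (nat_dsum y g) h"
      unfolding base_change_nat_adder[OF h y]
    proof (rule nat_arrow_eqI[OF nat_dsum_Hom[OF x] Comp_set_cat_Hom[OF h nat_dsum_Hom[OF y]]])
      fix u assume "u \<in> U"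
      then show "val (nat_dsum x (Comp set_cat g (mk (nat_ext (Comp set_cat y h)) (nat_ext y)
            (\<lambda>w. pair (sfun h (pfst w)) (psnd w))))) u = val (Comp set_cat (nat_dsum y g) h) u"
        by (simp add: eq[symmetric] Hom_sdom[OF h] Hom_sdom[OF y] Hom_app[OF h])
    qed
  next
    fix x f g :: "'a set_arrow" and U
    assume *: "x \<in> Hom set_cat U natA" "f \<in> Hom set_cat (nat_ext x) natA"
      "g \<in> Hom set_cat (nat_ext (nat_dsum x f)) natA"
    show "nat_dsum (nat_dsum x f) g = nat_dsum x (nat_dsum f (Comp set_cat g (nat_flat x f)))"
      by (rule nat_dsum_assoc[OF *(1,2)])
    show "Comp set_cat (nat_flat (nat_dsum x f) g) (base_change set_cat nat_adder g (nat_flat x f)) =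
      Comp set_cat (nat_flat x (nat_dsum f (Comp set_cat g (nat_flat x f))))
        (nat_flat f (Comp set_cat g (nat_flat x f)))"
      by (rule nat_flat_assoc[OF *])
  qed
qed

lemma nat_dsum_commute:
  assumes x: "x \<in> Hom set_cat U natA" and y: "y \<in> Hom set_cat U natA"
  shows "nat_dsum y (nat_dsum (Comp set_cat x (prU nat_adder y)) f) =
    nat_dsum x (nat_dsum (Comp set_cat y (prU nat_adder x))
      (Comp set_cat f (switch set_cat nat_adder x y)))"
  unfolding switch_nat_adder[OF x y]
proof (rule nat_arrow_eqI[OF nat_dsum_Hom[OF y] nat_dsum_Hom[OF x]])
  fix u assume u: "u \<in> U"
  let ?h = "\<lambda>j i. val f (pair (pair u (Num j)) (Num i))"
  have "(\<Sum>j = 1..val y u. \<Sum>i = 1..val x u. ?h j i) = (\<Sum>i = 1..val x u. \<Sum>j = 1..val y u. ?h j i)"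
    by (rule sum.swap)
  then show "val (nat_dsum y (nat_dsum (Comp set_cat x (prU nat_adder y)) f)) u =
      val (nat_dsum x (nat_dsum (Comp set_cat y (prU nat_adder x))
        (Comp set_cat f (mk (nat_ext (Comp set_cat y (prU nat_adder x)))
          (nat_ext (Comp set_cat x (prU nat_adder y)))
          (\<lambda>w. pair (pair (pfst (pfst w)) (psnd w)) (psnd (pfst w))))))) u"
    using u by (simp add: Hom_sdom[OF x] Hom_sdom[OF y])
qed

theorem mainTheorem1:
  "commutative_dependent_adder
     (set_cat :: ('a univ set, 'a set_arrow) cat) point nat_adder"
proof -
  interpret dependent_adder "set_cat :: ('a univ set, 'a set_arrow) cat" point nat_adder
    by (rule dependent_adder_nat)
  show ?thesis
    by unfold_locales (unfold nat_adder_simps(1-7), rule nat_dsum_commute)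
qed

end
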